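(* Let $M$ be a fixed positive integer. The following decision problem is solvable in time $O(|V|^2)$ and space $O(|V|)$: given a finite tree $G=(V,E)$, a subset $V'\subseteq V$ and a function $f':V'\to\mathbb{Z}$, decide whether there exists an $M$-Lipschitz mapping $f$ of $G$ such that $f$ extends $f'$ (i.e. $f(v)=f'(v)$ for all $v\in V'$).
   Context: An $M$-Lipschitz mapping of a connected graph $G=(V,E)$ is a mapping $f:V\to\mathbb{Z}$ such that $|f(u)-f(v)|\le M$ for every edge $uv\in E$ and some vertex, the root, is mapped to $0$. In this problem the root is not part of the input: $f$ is only required to take the value $0$ at some vertex of $G$. Time and space are counted as usual for graph algorithms, with storing an integer and performing an arithmetic operation or comparison on integers having unit cost. *)

theory Defs
  imports Complex_Main "HOL-Library.Landau_Symbols"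
begin

subsection \<open>Trees and Lipschitz mappings\<close>

text \<open>A finite simple graph is a finite vertex set with a set of two-element edges.\<close>

definition simple_graph :: "'a set \<Rightarrow> 'a set set \<Rightarrow> bool" where
  "simple_graph V E \<longleftrightarrow>
     finite V \<and> (\<forall>e\<in>E. \<exists>u v. e = {u, v} \<and> u \<in> V \<and> v \<in> V \<and> u \<noteq> v)"

definition connected_graph :: "'a set \<Rightarrow> 'a set set \<Rightarrow> bool" where
  "connected_graph V E \<longleftrightarrow>
     V \<noteq> {} \<and> (\<forall>u\<in>V. \<forall>v\<in>V. (u, v) \<in> {(x, y). {x, y} \<in> E}\<^sup>*)"

definition graph_cycle :: "'a set set \<Rightarrow> 'a list \<Rightarrow> bool" where
  "graph_cycle E p \<longleftrightarrow>
     3 \<le> length p \<and> distinct p \<and>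
     (\<forall>i<length p. {p ! i, p ! (Suc i mod length p)} \<in> E)"

definition tree_graph :: "'a set \<Rightarrow> 'a set set \<Rightarrow> bool" where
  "tree_graph V E \<longleftrightarrow>
     simple_graph V E \<and> connected_graph V E \<and> (\<nexists>p. graph_cycle E p)"

text \<open>Mappings of the graph are total functions whose values outside \<open>V\<close> are irrelevant.\<close>

definition lipschitz_mapping ::
    "int \<Rightarrow> 'a set \<Rightarrow> 'a set set \<Rightarrow> ('a \<Rightarrow> int) \<Rightarrow> bool" where
  "lipschitz_mapping M V E f \<longleftrightarrow>
     (\<forall>u v. {u, v} \<in> E \<longrightarrow> \<bar>f u - f v\<bar> \<le> M) \<and> (\<exists>r\<in>V. f r = 0)"

definition has_lipschitz_extension ::
    "int \<Rightarrow> 'a set \<Rightarrow> 'a set set \<Rightarrow> 'a set \<Rightarrow> ('a \<Rightarrow> int) \<Rightarrow> bool" where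
  "has_lipschitz_extension M V E V' f' \<longleftrightarrow>
     (\<exists>f. lipschitz_mapping M V E f \<and> (\<forall>v\<in>V'. f v = f' v))"


subsection \<open>Unit-cost random access machine\<close>

text \<open>
  Structured programs for a random access machine: finitely many integer registers and an
  integer memory with indirect addressing.  As in the machine of Cook and Reckhow, addition and
  subtraction are the only arithmetic operations.  With unit-cost multiplication and division one
  could pack arbitrarily much data into one integer, and the space bound would lose its meaning.
\<close>

type_synonym reg = nat

datatype com =
    Skip
  | Const reg int
  | Add reg reg reg
  | Sub reg reg reg
  | Load reg reg      \<comment> \<open>\<open>Load x a\<close>: register \<open>x\<close> receives the cell addressed by register \<open>a\<close>\<close>
  | Store reg reg     \<comment> \<open>\<open>Store a x\<close>: the cell addressed by register \<open>a\<close> receives register \<open>x\<close>\<close>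
  | Seq com com
  | IfLess reg reg com com
  | WhileLess reg reg com

text \<open>Register contents and memory contents.\<close>

type_synonym state = "(reg \<Rightarrow> int) \<times> (nat \<Rightarrow> int)"

text \<open>
  \<open>exec c \<sigma> t s \<tau>\<close>: started in \<open>\<sigma>\<close>, the program \<open>c\<close> halts in \<open>\<tau>\<close> after \<open>t\<close> steps, where each
  instruction and each evaluation of a test is one step, and \<open>s\<close> is the least number such that all
  accessed memory addresses are below \<open>s\<close>.  There is no rule for an access to a negative address,
  so such a run does not halt.
\<close>

inductive exec :: "com \<Rightarrow> state \<Rightarrow> nat \<Rightarrow> nat \<Rightarrow> state \<Rightarrow> bool" where
  Skip: "exec Skip \<sigma> 1 0 \<sigma>"
| Const: "exec (Const x k) (r, m) 1 0 (r(x := k), m)"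
| Add: "exec (Add x y z) (r, m) 1 0 (r(x := r y + r z), m)"
| Sub: "exec (Sub x y z) (r, m) 1 0 (r(x := r y - r z), m)"
| Load: "0 \<le> r a \<Longrightarrow> exec (Load x a) (r, m) 1 (Suc (nat (r a))) (r(x := m (nat (r a))), m)"
| Store: "0 \<le> r a \<Longrightarrow> exec (Store a x) (r, m) 1 (Suc (nat (r a))) (r, m(nat (r a) := r x))"
| Seq: "exec c1 \<sigma> t1 s1 \<rho> \<Longrightarrow> exec c2 \<rho> t2 s2 \<tau> \<Longrightarrow>
    exec (Seq c1 c2) \<sigma> (t1 + t2) (max s1 s2) \<tau>"
| IfTrue: "r x < r y \<Longrightarrow> exec c1 (r, m) t s \<tau> \<Longrightarrow>
    exec (IfLess x y c1 c2) (r, m) (1 + t) s \<tau>"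
| IfFalse: "\<not> r x < r y \<Longrightarrow> exec c2 (r, m) t s \<tau> \<Longrightarrow>
    exec (IfLess x y c1 c2) (r, m) (1 + t) s \<tau>"
| WhileFalse: "\<not> r x < r y \<Longrightarrow> exec (WhileLess x y c) (r, m) 1 0 (r, m)"
| WhileTrue: "r x < r y \<Longrightarrow> exec c (r, m) t1 s1 \<rho> \<Longrightarrow>
    exec (WhileLess x y c) \<rho> t2 s2 \<tau> \<Longrightarrow>
    exec (WhileLess x y c) (r, m) (1 + t1 + t2) (max s1 s2) \<tau>"

inductive_cases exec_elims:
  "exec Skip \<sigma> t s \<tau>"
  "exec (Const x k) \<sigma> t s \<tau>"
  "exec (Add x y z) \<sigma> t s \<tau>"
  "exec (Sub x y z) \<sigma> t s \<tau>"
  "exec (Load x a) \<sigma> t s \<tau>"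
  "exec (Store a x) \<sigma> t s \<tau>"
  "exec (Seq c1 c2) \<sigma> t s \<tau>"
  "exec (IfLess x y c1 c2) \<sigma> t s \<tau>"
  "exec (WhileLess x y c) \<sigma> t s \<tau>"

text \<open>Every program has at most one halting run from a given state.\<close>

lemma exec_deterministic:
  "exec c \<sigma> t s \<tau> \<Longrightarrow> exec c \<sigma> t' s' \<tau>' \<Longrightarrow> t' = t \<and> s' = s \<and> \<tau>' = \<tau>"
proof (induction arbitrary: t' s' \<tau>' rule: exec.induct)
  case (Seq c1 \<sigma> t1 s1 \<rho> c2 t2 s2 \<tau>)
  from Seq.prems obtain u1 p1 \<rho>' u2 p2 where
    eqs: "t' = u1 + u2" "s' = max p1 p2" and
    run: "exec c1 \<sigma> u1 p1 \<rho>'" "exec c2 \<rho>' u2 p2 \<tau>'"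
    by (rule exec_elims(7))
  from Seq.IH(1)[OF run(1)] have first: "u1 = t1" "p1 = s1" "\<rho>' = \<rho>" by blast+
  from Seq.IH(2)[OF run(2)[unfolded first]] have "u2 = t2" "p2 = s2" by blast+
  with first eqs Seq.IH(2)[OF run(2)[unfolded first]] show ?case by simp
next
  case (IfTrue r x y c1 m t s \<tau> c2)
  from IfTrue.prems IfTrue.hyps obtain u where u: "t' = 1 + u" "exec c1 (r, m) u s' \<tau>'"
    by (cases rule: exec_elims(8)) auto
  with IfTrue.IH[OF u(2)] show ?case by simp
next
  case (IfFalse r x y c2 m t s \<tau> c1)
  from IfFalse.prems IfFalse.hyps obtain u where u: "t' = 1 + u" "exec c2 (r, m) u s' \<tau>'"
    by (cases rule: exec_elims(8)) auto
  with IfFalse.IH[OF u(2)] show ?case by simp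
next
  case (WhileFalse r x y c m)
  from WhileFalse.prems WhileFalse.hyps show ?case by (cases rule: exec_elims(9)) auto
next
  case (WhileTrue r x y c m t1 s1 \<rho> t2 s2 \<tau>)
  from WhileTrue.prems WhileTrue.hyps obtain u1 p1 \<rho>' u2 p2 where
    eqs: "t' = 1 + u1 + u2" "s' = max p1 p2" and
    run: "exec c (r, m) u1 p1 \<rho>'" "exec (WhileLess x y c) \<rho>' u2 p2 \<tau>'"
    by (cases rule: exec_elims(9)) auto
  from WhileTrue.IH(1)[OF run(1)] have first: "u1 = t1" "p1 = s1" "\<rho>' = \<rho>" by blast+
  from WhileTrue.IH(2)[OF run(2)[unfolded first]] have "u2 = t2" "p2 = s2" by blast+
  with first eqs WhileTrue.IH(2)[OF run(2)[unfolded first]] show ?case by simp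
qed (erule exec_elims(1-6); simp)+

primrec registers :: "com \<Rightarrow> reg set" where
  "registers Skip = {}"
| "registers (Const x k) = {x}"
| "registers (Add x y z) = {x, y, z}"
| "registers (Sub x y z) = {x, y, z}"
| "registers (Load x a) = {x, a}"
| "registers (Store a x) = {a, x}"
| "registers (Seq c1 c2) = registers c1 \<union> registers c2"
| "registers (IfLess x y c1 c2) = {x, y} \<union> registers c1 \<union> registers c2"
| "registers (WhileLess x y c) = {x, y} \<union> registers c"

text \<open>The input occupies the first memory cells; everything else is initially zero.\<close>

definition initial_state :: "int list \<Rightarrow> state" where
  "initial_state xs = (\<lambda>_. 0, \<lambda>a. if a < length xs then xs ! a else 0)"

text \<open>
  A single program has to halt on every encoding of every instance and leave the answer (1 for
  yes, 0 for no) in register 0.  The space consists of the registers, the input cells and all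
  memory cells up to the largest accessed address.
\<close>

definition solvable_in_time_space ::
    "'i set \<Rightarrow> ('i \<Rightarrow> int list set) \<Rightarrow> ('i \<Rightarrow> bool) \<Rightarrow> ('i \<Rightarrow> nat) \<Rightarrow>
     (nat \<Rightarrow> real) \<Rightarrow> (nat \<Rightarrow> real) \<Rightarrow> bool" where
  "solvable_in_time_space instances encodings answer inst_size time space \<longleftrightarrow>
     (\<exists>P T S. (\<lambda>n. real (T n)) \<in> O(time) \<and> (\<lambda>n. real (S n)) \<in> O(space) \<and>
        (\<forall>I\<in>instances. \<forall>xs\<in>encodings I. \<exists>t s \<tau>.
           exec P (initial_state xs) t s \<tau> \<and>
           fst \<tau> 0 = (if answer I then 1 else 0) \<and>
           t \<le> T (inst_size I) \<and>
           card (registers P) + max (length xs) s \<le> S (inst_size I)))"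


subsection \<open>The extension problem on trees\<close>

text \<open>
  Instances \<open>(V, E, V', f')\<close>.  As usual for graph algorithms, the vertices of the input graph are
  numbered \<open>0, \<dots>, n - 1\<close>.
\<close>

type_synonym extension_instance = "nat set \<times> nat set set \<times> nat set \<times> (nat \<Rightarrow> int)"

definition tree_extension_instances :: "extension_instance set" where
  "tree_extension_instances =
     {(V, E, V', f'). (\<exists>n. V = {..<n}) \<and> tree_graph V E \<and> V' \<subseteq> V}"

text \<open>
  The input consists of the numbers \<open>|V|\<close>, \<open>|E|\<close>, \<open>|V'|\<close>, followed by the edges and then by the
  pairs \<open>(v, f' v)\<close> with \<open>v \<in> V'\<close>.  Each edge and each pair is listed exactly once, in arbitrary
  order and with an arbitrary orientation of the edges.
\<close>

fun extension_encodings :: "extension_instance \<Rightarrow> int list set" where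
  "extension_encodings (V, E, V', f') =
     {[int (card V), int (length es), int (length vs)] @
        concat (map (\<lambda>(u, v). [int u, int v]) es) @ concat (map (\<lambda>v. [int v, f' v]) vs) | es vs.
      distinct (map (\<lambda>(u, v). {u, v}) es) \<and> set (map (\<lambda>(u, v). {u, v}) es) = E \<and>
      distinct vs \<and> set vs = V'}"

fun extension_answer :: "int \<Rightarrow> extension_instance \<Rightarrow> bool" where
  "extension_answer M (V, E, V', f') \<longleftrightarrow> has_lipschitz_extension M V E V' f'"

fun num_vertices :: "extension_instance \<Rightarrow> nat" where
  "num_vertices (V, E, V', f') = card V"

end

theory Submission
  imports Defs
begin

text \<open>
  A Lipschitz mapping of a connected graph with \<open>m\<close> edges vanishes somewhere, so its values lie
  in \<open>[-B, B]\<close> with \<open>B = 4 m M\<close>.  Starting from these bounds, with both bounds at \<open>v \<in> V'\<close> set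
  to \<open>f' v\<close>, Bellman--Ford relaxation of the upper and lower bounds along the edges reaches a fixed
  point \<open>(L, U)\<close> after at most \<open>4 m\<close> rounds.  Every solution lies between \<open>L\<close> and \<open>U\<close>.
  Conversely \<open>L\<close> and \<open>U\<close> are \<open>M\<close>-Lipschitz, so if \<open>L \<le> U\<close> everywhere and \<open>L r \<le> 0 \<le> U r\<close> for
  some \<open>r\<close>, then \<open>max L (min U 0)\<close> is a solution.  Being a tree matters only for \<open>m \<le> |V|\<close>, which
  turns the \<open>O(m\<^sup>2 + |V|)\<close> steps into \<open>O(|V|\<^sup>2)\<close>.
\<close>

section \<open>Edges of acyclic graphs\<close>

lemma simple_graph_subset:
  assumes "simple_graph V E" "e \<in> E"
  shows "e \<subseteq> V"
  using assms unfolding simple_graph_def by fastforce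

text \<open>The first vertex of a longest path works: a neighbour off the path could be prepended,
  and a neighbour at index 2 or later would close a cycle. If \<open>x\<close> is isolated,
  \<open>y\<close> is arbitrary.\<close>

lemma acyclic_graph_leaf:
  assumes G: "simple_graph V E" and V: "V \<noteq> {}" and acyc: "\<nexists>p. graph_cycle E p"
  obtains x y where "x \<in> V" "\<And>e. e \<in> E \<Longrightarrow> x \<in> e \<Longrightarrow> e = {x, y}"
proof -
  define path where
    "path = (\<lambda>p. p \<noteq> [] \<and> distinct p \<and> set p \<subseteq> V \<and> (\<forall>i. Suc i < length p \<longrightarrow> {p ! i, p ! Suc i} \<in> E))"
  have fin: "finite V" using G by (simp add: simple_graph_def)
  have bound: "\<forall>p. path p \<longrightarrow> length p < Suc (card V)"
    using fin unfolding path_def by (metis card_mono distinct_card less_Suc_eq_le)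
  obtain v where "v \<in> V" using V by blast
  then have "path [v]" by (simp add: path_def)
  then obtain p where p: "path p" and longest: "\<And>q. path q \<Longrightarrow> length q \<le> length p"
    using ex_has_greatest_nat[of path "[v]" length "Suc (card V)"] bound by (meson less_imp_le)
  have edge: "e = {p ! 0, p ! 1}" if e: "e \<in> E" "p ! 0 \<in> e" for e
  proof -
    obtain w where w: "e = {p ! 0, w}" "w \<in> V" "w \<noteq> p ! 0"
      using G e unfolding simple_graph_def by (metis doubleton_eq_iff insertE singletonD)
    have "w \<in> set p"
    proof (rule ccontr)
      assume "w \<notin> set p"
      moreover have "{(w # p) ! i, (w # p) ! Suc i} \<in> E" if "Suc i < length (w # p)" for i
        using that p w(1) e(1) by (cases i) (auto simp: path_def insert_commute)
      ultimately have "path (w # p)" using p w(2) unfolding path_def by auto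
      from longest[OF this] show False by simp
    qed
    then obtain i where i: "i < length p" "p ! i = w" by (auto simp: in_set_conv_nth)
    have "i < 2"
    proof (rule ccontr)
      assume "\<not> i < 2"
      \<comment> \<open>The prefix ending in \<open>w\<close> is closed to a cycle by
        \<open>e\<close>, which is the case \<open>j = i\<close>; it has at least 3 vertices because
        \<open>i\<close> is at least 2.\<close>
      have "{take (Suc i) p ! j, take (Suc i) p ! (Suc j mod Suc i)} \<in> E" if "j < Suc i" for j
        using p w(1) e(1) i that unfolding path_def by (cases "j = i") (auto simp: insert_commute)
      then have "graph_cycle E (take (Suc i) p)"
        using p i \<open>\<not> i < 2\<close> unfolding graph_cycle_def path_def by (simp add: min_absorb2)
      with acyc show False by blast
    qed
    with i w show ?thesis by (cases i) auto
  qed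
  have "p ! 0 \<in> V" using p unfolding path_def by auto
  with edge show ?thesis using that by blast
qed

text \<open>Removing the vertex \<open>x\<close> of \<open>acyclic_graph_leaf\<close> destroys at
  most one edge, since every edge at \<open>x\<close> equals \<open>{x, y}\<close>. The bound
  \<open>card V\<close> instead of \<open>card V - 1\<close> lets the induction start at the empty
  graph.\<close>

lemma acyclic_graph_card_edges:
  assumes "simple_graph V E" "\<nexists>p. graph_cycle E p"
  shows "card E \<le> card V"
  using assms
proof (induction "card V" arbitrary: V E)
  case 0
  then have "V = {}" by (simp add: simple_graph_def)
  with 0 have "E = {}" unfolding simple_graph_def by blast
  then show ?case by simp
next
  case (Suc k)
  then have V: "finite V" "V \<noteq> {}" by (auto simp: simple_graph_def)
  obtain x y where x: "x \<in> V" and xy: "\<And>e. e \<in> E \<Longrightarrow> x \<in> e \<Longrightarrow> e = {x, y}"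
    using acyclic_graph_leaf[OF Suc.prems(1) V(2) Suc.prems(2)] by metis
  define E' where "E' = {e \<in> E. x \<notin> e}"
  have k: "card (V - {x}) = k" using x V Suc.hyps(2) by simp
  have finE: "finite E"
    by (rule finite_subset[of _ "Pow V"]) (use V simple_graph_subset[OF Suc.prems(1)] in auto)
  have "simple_graph (V - {x}) E'"
    unfolding simple_graph_def
  proof (intro conjI ballI)
    fix e assume "e \<in> E'"
    then show "\<exists>u v. e = {u, v} \<and> u \<in> V - {x} \<and> v \<in> V - {x} \<and> u \<noteq> v"
      using Suc.prems(1) unfolding simple_graph_def E'_def by fastforce
  qed (use V in simp)
  moreover have "\<nexists>p. graph_cycle E' p"
    using Suc.prems(2) unfolding graph_cycle_def E'_def by blast
  ultimately have "card E' \<le> k" using Suc.hyps(1)[of "V - {x}" E'] k by simp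
  moreover have "card E \<le> card (insert {x, y} E')"
    by (rule card_mono) (use finE xy in \<open>auto simp: E'_def\<close>)
  then have "card E \<le> Suc (card E')"
    by (metis card_insert_if finE finite_insert finite_subset le_SucI le_trans E'_def mem_Collect_eq subsetI order_refl)
  ultimately show ?case using Suc.hyps(2) by simp
qed

section \<open>Bellman--Ford relaxation\<close>

text \<open>For \<open>M \<ge> 0\<close> at most one of the two tests can succeed, so one nested
  conditional handles both orientations of the edge.\<close>

fun relax :: "int \<Rightarrow> nat \<times> nat \<Rightarrow> (nat \<Rightarrow> int) \<Rightarrow> nat \<Rightarrow> int" where
  "relax M (a, b) A =
     (if A a + M < A b then A(b := A a + M)
      else if A b + M < A a then A(a := A b + M) else A)"

abbreviation sym_rel :: "('a \<times> 'a) list \<Rightarrow> ('a \<times> 'a) set" where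
  "sym_rel ps \<equiv> set ps \<union> (set ps)\<inverse>"

lemma card_sym_rel: "card (sym_rel ps) \<le> 2 * length ps"
proof -
  have "card (sym_rel ps) \<le> card (set ps) + card ((set ps)\<inverse>)" by (rule card_Un_le)
  also have "\<dots> \<le> 2 * length ps" using card_length[of ps] by (simp add: card_inverse)
  finally show ?thesis .
qed

lemma relax_le: "relax M e A x \<le> A x"
  by (cases e) auto

lemma fold_relax_le: "fold (relax M) ps A x \<le> A x"
  by (induction ps arbitrary: A) (auto intro: order_trans relax_le)

lemma relax_mono_edge:
  assumes "M \<ge> 0" "(a, b) = e \<or> (b, a) = e"
  shows "relax M e A b \<le> A a + M"
  using assms by auto

text \<open>The bound holds right after the edge itself is relaxed: earlier relaxations can only
  have lowered the value at \<open>a\<close>, later ones only lower the value at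
  \<open>b\<close>.\<close>

lemma fold_relax_edge:
  assumes "M \<ge> 0" "(a, b) \<in> sym_rel ps"
  shows "fold (relax M) ps A b \<le> A a + M"
  using assms(2)
proof (induction ps arbitrary: A)
  case (Cons e ps)
  show ?case
  proof (cases "(a, b) = e \<or> (b, a) = e")
    case True
    have "fold (relax M) (e # ps) A b \<le> relax M e A b" by (simp add: fold_relax_le)
    also have "\<dots> \<le> A a + M" using relax_mono_edge[OF assms(1) True] .
    finally show ?thesis .
  next
    case False
    with Cons.prems have "(a, b) \<in> sym_rel ps" by auto
    from Cons.IH[OF this, of "relax M e A"] relax_le[of M e A a] show ?thesis by simp
  qed
qed simp

text \<open>An update writes \<open>A a + M\<close> at \<open>b\<close>, and this is at least
  \<open>g a + M\<close>, hence at least \<open>g b\<close>.\<close>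

lemma fold_relax_lower_bound:
  assumes "\<And>x. g x \<le> A x" "\<And>a b. (a, b) \<in> sym_rel ps \<Longrightarrow> g b \<le> g a + M"
  shows "g x \<le> fold (relax M) ps A x"
  using assms
proof (induction ps arbitrary: A)
  case (Cons e ps)
  obtain a b where e: "e = (a, b)" by force
  have "g b \<le> g a + M" "g a \<le> g b + M" using Cons.prems(2) e by auto
  then have "g y \<le> relax M e A y" for y
    using Cons.prems(1)[of a] Cons.prems(1)[of b] Cons.prems(1)[of y] e by auto
  moreover have "g b \<le> g a + M" if "(a, b) \<in> sym_rel ps" for a b
    using Cons.prems(2)[of a b] that by auto
  ultimately show ?case using Cons.IH by simp
qed simp

text \<open>Each update extends a walk by one step and adds one \<open>M\<close>. Both
  \<open>A0\<close> and the relation \<open>R\<close> are kept apart from the list, so that they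
  stay fixed while \<open>A\<close> and \<open>ps\<close> change in the induction.\<close>

lemma fold_relax_attained:
  assumes "\<And>x. \<exists>y k. (y, x) \<in> R ^^ k \<and> A x = A0 y + M * int k" "sym_rel ps \<subseteq> R"
  shows "\<exists>y k. (y, x) \<in> R ^^ k \<and> fold (relax M) ps A x = A0 y + M * int k"
  using assms
proof (induction ps arbitrary: A)
  case (Cons e ps)
  obtain a b where e: "e = (a, b)" by force
  have step: "\<exists>y k. (y, d) \<in> R ^^ k \<and> A c + M = A0 y + M * int k" if cd: "(c, d) \<in> R" for c d
  proof -
    obtain y k where "(y, c) \<in> R ^^ k" "A c = A0 y + M * int k" using Cons.prems(1) by blast
    then have "(y, d) \<in> R ^^ Suc k \<and> A c + M = A0 y + M * int (Suc k)"
      using cd by (auto simp: algebra_simps)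
    then show ?thesis by blast
  qed
  have "(a, b) \<in> R" "(b, a) \<in> R" using Cons.prems(2) e by auto
  then have "\<exists>y k. (y, x) \<in> R ^^ k \<and> relax M e A x = A0 y + M * int k" for x
    using step[of a b] step[of b a] Cons.prems(1)[of x] e by auto
  moreover have "sym_rel ps \<subseteq> R" using Cons.prems(2) by auto
  ultimately show ?case using Cons.IH by simp
qed simp

text \<open>A walk in a finite relation can be shortened to at most as many steps as the relation
  has pairs. Counting pairs instead of vertices ties the number of rounds to the length of the edge
  list.\<close>

lemma relpow_sym_rel_bounded:
  assumes "(y, x) \<in> (sym_rel ps) ^^ k"
  obtains j where "j \<le> k" "j \<le> 2 * length ps" "(y, x) \<in> (sym_rel ps) ^^ j"
proof (cases "k \<le> 2 * length ps")
  case False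
  obtain j where "j \<le> card (sym_rel ps)" "(y, x) \<in> (sym_rel ps) ^^ j"
    using relpow_finite_bounded[of "sym_rel ps" k] assms by auto
  with False card_sym_rel[of ps] that show ?thesis by (metis le_trans nat_le_linear)
qed (use assms that in auto)

text \<open>Values are attained along walks, and walks can be shortened to the number of rounds.\<close>

lemma relax_rounds_stable:
  assumes M: "M \<ge> 0" and N: "2 * length ps \<le> N" and ab: "(a, b) \<in> sym_rel ps"
  shows "(fold (relax M) ps ^^ N) A b \<le> (fold (relax M) ps ^^ N) A a + M"
proof -
  let ?F = "\<lambda>i. (fold (relax M) ps ^^ i) A" and ?R = "sym_rel ps"
  have attained: "\<exists>y k. (y, x) \<in> ?R ^^ k \<and> ?F i x = A y + M * int k" for i x
  proof (induction i arbitrary: x)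
    case 0
    have "(x, x) \<in> ?R ^^ 0 \<and> ?F 0 x = A x + M * int 0" by simp
    then show ?case by blast
  next
    case (Suc i)
    show ?case using fold_relax_attained[OF Suc subset_refl] by simp
  qed
  \<comment> \<open>Each round relaxes every edge, so \<open>i\<close> rounds account for all walks
    of at most \<open>i\<close> steps.\<close>
  have below: "?F i x \<le> A y + M * int k" if "(y, x) \<in> ?R ^^ k" "k \<le> i" for i k x y
    using that
  proof (induction i arbitrary: k x)
    case (Suc i)
    show ?case
    proof (cases k)
      case 0
      have "?F (Suc i) x \<le> ?F i x" by (simp add: fold_relax_le)
      with Suc.IH[of x 0] Suc.prems(1) 0 show ?thesis by simp
    next
      case (Suc j)
      then obtain z where z: "(y, z) \<in> ?R ^^ j" "(z, x) \<in> ?R" using Suc.prems(1) by auto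
      have "?F (Suc i) x \<le> ?F i z + M" using fold_relax_edge[OF M z(2)] by simp
      with Suc.IH[OF z(1)] Suc.prems(2) Suc show ?thesis by (simp add: algebra_simps)
    qed
  qed simp
  obtain y k where yk: "(y, a) \<in> ?R ^^ k" "?F N a = A y + M * int k" using attained by blast
  \<comment> \<open>The walk attaining the value at \<open>a\<close>, prolonged to \<open>b\<close>,
    may have more than \<open>N\<close> steps. Its shortening does not, so \<open>below\<close>
    applies, and fewer steps cost no more since \<open>M \<ge> 0\<close>.\<close>
  then have "(y, b) \<in> ?R ^^ Suc k" using ab by auto
  then obtain j where j: "j \<le> Suc k" "j \<le> 2 * length ps" "(y, b) \<in> ?R ^^ j"
    by (rule relpow_sym_rel_bounded)
  then have "?F N b \<le> A y + M * int j" using below N by simp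
  also have "\<dots> \<le> A y + M * int (Suc k)" using M j(1) by (intro add_left_mono mult_left_mono) auto
  finally show ?thesis using yk(2) by (simp add: algebra_simps)
qed

lemma relax_rounds_lower_bound:
  assumes "\<And>x. g x \<le> A x" "\<And>a b. (a, b) \<in> sym_rel ps \<Longrightarrow> g b \<le> g a + M"
  shows "g x \<le> (fold (relax M) ps ^^ N) A x"
proof (induction N arbitrary: x)
  case (Suc N)
  show ?case using fold_relax_lower_bound[OF Suc assms(2)] by simp
qed (simp add: assms)

lemma lipschitz_along_walk:
  fixes f :: "'a \<Rightarrow> int"
  assumes "\<And>a b. (a, b) \<in> R \<Longrightarrow> \<bar>f a - f b\<bar> \<le> M" "(y, x) \<in> R ^^ k"
  shows "\<bar>f y - f x\<bar> \<le> M * int k"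
  using assms(2)
proof (induction k arbitrary: x)
  case (Suc k)
  then obtain z where "(y, z) \<in> R ^^ k" "(z, x) \<in> R" by auto
  with Suc.IH[of z] assms(1)[of z x] show ?case by (simp add: algebra_simps)
qed simp

section \<open>The bounds decide the extension problem\<close>

text \<open>Cell \<open>v < n\<close> holds an upper bound for the value at \<open>v\<close>, cell \<open>n + v\<close> the negative of a
  lower bound, so that both kinds of bounds are tightened by the same relaxation.\<close>

fun relax_both :: "int \<Rightarrow> nat \<Rightarrow> nat \<times> nat \<Rightarrow> (nat \<Rightarrow> int) \<Rightarrow> nat \<Rightarrow> int" where
  "relax_both M n (u, v) A = relax M (n + u, n + v) (relax M (u, v) A)"

definition pin :: "nat \<Rightarrow> (nat \<Rightarrow> int) \<Rightarrow> nat \<Rightarrow> (nat \<Rightarrow> int) \<Rightarrow> nat \<Rightarrow> int" where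
  "pin n f' v A = A(v := f' v, n + v := - f' v)"

text \<open>The edge list of two disjoint copies of the graph, one for the upper bounds and one for
  the negated lower bounds. It reduces \<open>relax_both\<close> to the facts about
  \<open>relax\<close>.\<close>

definition doubled :: "nat \<Rightarrow> (nat \<times> nat) list \<Rightarrow> (nat \<times> nat) list" where
  "doubled n es = concat (map (\<lambda>(u, v). [(u, v), (n + u, n + v)]) es)"

lemma length_doubled: "length (doubled n es) = 2 * length es"
  by (induction es) (auto simp: doubled_def)

lemma fold_relax_both: "fold (relax_both M n) es = fold (relax M) (doubled n es)"
  by (induction es) (auto simp: doubled_def)

lemma set_doubled:
  "set (doubled n es) = set es \<union> (\<lambda>(u, v). (n + u, n + v)) ` set es"
  by (auto simp: doubled_def)

text \<open>The value 0 beyond the \<open>2 * n\<close> bounds agrees with the untouched memory of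
  the machine.\<close>

definition init_bounds :: "int \<Rightarrow> nat \<Rightarrow> (nat \<Rightarrow> int) \<Rightarrow> nat list \<Rightarrow> nat \<Rightarrow> int" where
  "init_bounds B n f' vs = fold (pin n f') vs (\<lambda>a. if a < 2 * n then B else 0)"

text \<open>Since all entries of \<open>vs\<close> are below \<open>n\<close>, the cells
  \<open>v\<close> and \<open>n + v\<close> never collide.\<close>

lemma fold_pin:
  assumes "set vs \<subseteq> {..<n}"
  shows "fold (pin n f') vs A a =
    (if a \<in> set vs then f' a else if n \<le> a \<and> a - n \<in> set vs then - f' (a - n) else A a)"
  using assms
proof (induction vs arbitrary: A)
  case (Cons v vs)
  then have "fold (pin n f') (v # vs) A a =
    (if a \<in> set vs then f' a else if n \<le> a \<and> a - n \<in> set vs then - f' (a - n)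
     else pin n f' v A a)" by simp
  also have "\<dots> = (if a \<in> set (v # vs) then f' a
     else if n \<le> a \<and> a - n \<in> set (v # vs) then - f' (a - n) else A a)"
    using Cons.prems by (auto simp: pin_def)
  finally show ?case .
qed simp

lemma extension_iff_bounds:
  fixes n :: nat and es :: "(nat \<times> nat) list"
  assumes M: "M \<ge> 0"
    and conn: "connected_graph {..<n} ((\<lambda>(u, v). {u, v}) ` set es)"
    and es: "\<And>u v. (u, v) \<in> set es \<Longrightarrow> u < n \<and> v < n"
    and vs: "set vs \<subseteq> {..<n}"
    and A: "A = (fold (relax_both M n) es ^^ (4 * length es))
      (init_bounds (M * int (4 * length es)) n f' vs)"
  shows "has_lipschitz_extension M {..<n} ((\<lambda>(u, v). {u, v}) ` set es) (set vs) f' \<longleftrightarrow>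
    (\<forall>v<n. 0 \<le> A v + A (n + v)) \<and> (\<exists>v<n. 0 \<le> A v \<and> 0 \<le> A (n + v))"
proof -
  let ?E = "(\<lambda>(u, v). {u, v}) ` set es"
  let ?B = "M * int (4 * length es)"
  define A0 where "A0 = init_bounds ?B n f' vs"
  define ds where "ds = doubled n es"
  \<comment> \<open>Doubling turns \<open>4 * length es\<close> rounds into
    \<open>2 * length ds\<close>, the number required by \<open>relax_rounds_stable\<close>.\<close>
  have A_ds: "A = (fold (relax M) ds ^^ (2 * length ds)) A0"
    by (simp add: A A0_def ds_def fold_relax_both length_doubled)
  have edge_iff: "{u, v} \<in> ?E \<longleftrightarrow> (u, v) \<in> sym_rel es" for u v
    by (auto simp: image_iff doubleton_eq_iff)
  have edge_rel: "{(u, v). {u, v} \<in> ?E} = sym_rel es"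
    unfolding edge_iff by auto
  have A0: "A0 a = (if a \<in> set vs then f' a else if n \<le> a \<and> a - n \<in> set vs then - f' (a - n)
      else if a < 2 * n then ?B else 0)" for a
    unfolding A0_def init_bounds_def by (rule fold_pin[OF vs])
  have A_le: "A a \<le> A0 a" for a
  proof -
    have "(fold (relax M) ds ^^ i) A0 a \<le> A0 a" for i
    proof (induction i)
      case (Suc i)
      have "(fold (relax M) ds ^^ Suc i) A0 a \<le> (fold (relax M) ds ^^ i) A0 a"
        by (simp add: fold_relax_le)
      with Suc show ?case by simp
    qed simp
    then show ?thesis by (simp add: A_ds)
  qed
  show ?thesis
  proof
    assume "has_lipschitz_extension M {..<n} ?E (set vs) f'"
    then obtain f where f: "lipschitz_mapping M {..<n} ?E f"
      and ext: "\<And>v. v \<in> set vs \<Longrightarrow> f v = f' v"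
      unfolding has_lipschitz_extension_def by blast
    from f have lip: "\<And>u v. (u, v) \<in> sym_rel es \<Longrightarrow> \<bar>f u - f v\<bar> \<le> M"
      unfolding lipschitz_mapping_def edge_iff by blast
    from f obtain r where r: "r < n" "f r = 0" unfolding lipschitz_mapping_def by blast
    \<comment> \<open>A shortened walk from the root \<open>r\<close> has at most
      \<open>2 * length es\<close> steps. The bound \<open>?B\<close> allows twice that, so that the
      program can compute it with its round counter.\<close>
    have f_le: "\<bar>f v\<bar> \<le> ?B" if "v < n" for v
    proof -
      have "(r, v) \<in> (sym_rel es)\<^sup>*"
        using conn r that unfolding connected_graph_def edge_rel by simp
      then obtain k where "(r, v) \<in> (sym_rel es) ^^ k" by (auto simp: rtrancl_power)
      then obtain j where j: "j \<le> 2 * length es" "(r, v) \<in> (sym_rel es) ^^ j"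
        by (rule relpow_sym_rel_bounded)
      have "\<bar>f r - f v\<bar> \<le> M * int j" by (rule lipschitz_along_walk[OF lip j(2)])
      also have "\<dots> \<le> ?B" using j(1) M by (intro mult_left_mono) auto
      finally show ?thesis using r by simp
    qed
    \<comment> \<open>A solution becomes a feasible function on both copies: \<open>f\<close> on the
      upper one, \<open>- f\<close> on the lower one. Beyond the array it agrees with
      \<open>A0\<close>, because \<open>f\<close> is unconstrained there.\<close>
    define g where "g a = (if a < n then f a else if a < 2 * n then - f (a - n) else A0 a)" for a
    have "g a \<le> A0 a" for a
    proof (cases "a < n")
      case True
      with f_le[of a] ext[of a] show ?thesis unfolding g_def A0 by auto
    next
      case False
      show ?thesis
      proof (cases "a < 2 * n")
        case True
        with False vs have "a \<notin> set vs" "a - n < n" by auto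
        with True False f_le[of "a - n"] ext[of "a - n"] show ?thesis unfolding g_def A0 by auto
      qed (use False in \<open>auto simp: g_def\<close>)
    qed
    moreover have "g b \<le> g a + M" if "(a, b) \<in> sym_rel ds" for a b
    proof -
      have "(a, b) \<in> sym_rel es \<or> (\<exists>u v. (u, v) \<in> sym_rel es \<and> a = n + u \<and> b = n + v)"
        using that by (auto simp: ds_def set_doubled)
      then show ?thesis
      proof
        assume "(a, b) \<in> sym_rel es"
        moreover from this have "a < n" "b < n" using es by auto
        ultimately show ?thesis using lip[of a b] by (auto simp: g_def)
      next
        assume "\<exists>u v. (u, v) \<in> sym_rel es \<and> a = n + u \<and> b = n + v"
        then obtain u v where uv: "(u, v) \<in> sym_rel es" "a = n + u" "b = n + v" by blast
        then have "u < n" "v < n" using es by auto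
        with uv lip[of u v] show ?thesis by (auto simp: g_def)
      qed
    qed
    ultimately have g: "g a \<le> A a" for a unfolding A_ds by (rule relax_rounds_lower_bound)
    have "f v \<le> A v" "- f v \<le> A (n + v)" if "v < n" for v
      using g[of v] g[of "n + v"] that by (auto simp: g_def)
    then show "(\<forall>v<n. 0 \<le> A v + A (n + v)) \<and> (\<exists>v<n. 0 \<le> A v \<and> 0 \<le> A (n + v))"
      using r by fastforce
  next
    assume asm: "(\<forall>v<n. 0 \<le> A v + A (n + v)) \<and> (\<exists>v<n. 0 \<le> A v \<and> 0 \<le> A (n + v))"
    then obtain r where r: "r < n" "0 \<le> A r" "0 \<le> A (n + r)" by blast
    have stable: "A b \<le> A a + M" if "(a, b) \<in> sym_rel ds" for a b
      unfolding A_ds using relax_rounds_stable[OF M order_refl that] .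
    \<comment> \<open>This clamps 0 to the interval from \<open>- A (n + v)\<close> to
      \<open>A v\<close>; clamping preserves the Lipschitz condition of the two bounds.\<close>
    define f where "f v = max (- A (n + v)) (min (A v) 0)" for v
    have "\<bar>f u - f v\<bar> \<le> M" if "(u, v) \<in> sym_rel es" for u v
    proof -
      have "{(u, v), (v, u), (n + u, n + v), (n + v, n + u)} \<subseteq> sym_rel ds"
        using that by (auto simp: ds_def set_doubled)
      then have "A v \<le> A u + M" "A u \<le> A v + M" "A (n + v) \<le> A (n + u) + M"
        "A (n + u) \<le> A (n + v) + M" using stable by auto
      then show ?thesis using M unfolding f_def by linarith
    qed
    moreover have "f r = 0" using r by (simp add: f_def)
    moreover have "f v = f' v" if v: "v \<in> set vs" for v
    proof -
      have "v < n" "n + v \<notin> set vs" using v vs by auto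
      \<comment> \<open>The interval at \<open>v\<close> starts as the single point
        \<open>f' v\<close> and only shrinks; being nonempty, it is still that point.\<close>
      then have "A v \<le> f' v" "A (n + v) \<le> - f' v" "0 \<le> A v + A (n + v)"
        using A_le[of v] A_le[of "n + v"] v asm by (auto simp: A0)
      then show ?thesis unfolding f_def by linarith
    qed
    ultimately show "has_lipschitz_extension M {..<n} ?E (set vs) f'"
      unfolding has_lipschitz_extension_def lipschitz_mapping_def edge_iff using r(1) by blast
  qed
qed

section \<open>Hoare triples with time and space bounds\<close>

text \<open>Total correctness, as a halting run is demanded. Times add up under composition while
  spaces combine by maximum, so one \<open>S\<close> can serve all parts of a program.\<close>

definition triple :: "nat \<Rightarrow> nat \<Rightarrow> (state \<Rightarrow> bool) \<Rightarrow> com \<Rightarrow> (state \<Rightarrow> bool) \<Rightarrow> bool" where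
  "triple S T P c Q \<longleftrightarrow>
     (\<forall>\<sigma>. P \<sigma> \<longrightarrow> (\<exists>t s \<tau>. exec c \<sigma> t s \<tau> \<and> t \<le> T \<and> s \<le> S \<and> Q \<tau>))"

primrec wp :: "nat \<Rightarrow> com \<Rightarrow> (state \<Rightarrow> bool) \<Rightarrow> state \<Rightarrow> bool" where
  "wp S Skip Q = Q"
| "wp S (Const x k) Q = (\<lambda>(r, m). Q (r(x := k), m))"
| "wp S (Add x y z) Q = (\<lambda>(r, m). Q (r(x := r y + r z), m))"
| "wp S (Sub x y z) Q = (\<lambda>(r, m). Q (r(x := r y - r z), m))"
| "wp S (Load x a) Q =
     (\<lambda>(r, m). 0 \<le> r a \<and> nat (r a) < S \<and> Q (r(x := m (nat (r a))), m))"
| "wp S (Store a x) Q =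
     (\<lambda>(r, m). 0 \<le> r a \<and> nat (r a) < S \<and> Q (r, m(nat (r a) := r x)))"
| "wp S (Seq c1 c2) Q = wp S c1 (wp S c2 Q)"
| "wp S (IfLess x y c1 c2) Q =
     (\<lambda>(r, m). if r x < r y then wp S c1 Q (r, m) else wp S c2 Q (r, m))"
| "wp S (WhileLess x y c) Q = (\<lambda>_. False)"

text \<open>The value for loops is junk: \<open>wp\<close> rejects them.\<close>

primrec cost :: "com \<Rightarrow> nat" where
  "cost Skip = 1"
| "cost (Const x k) = 1"
| "cost (Add x y z) = 1"
| "cost (Sub x y z) = 1"
| "cost (Load x a) = 1"
| "cost (Store a x) = 1"
| "cost (Seq c1 c2) = cost c1 + cost c2"
| "cost (IfLess x y c1 c2) = 1 + (cost c1 + cost c2)"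
| "cost (WhileLess x y c) = 0"

text \<open>Loop-free code has a time bound independent of the state. For a conditional
  \<open>cost\<close> adds both branches, which bounds whichever one is taken; loops are excluded
  because their \<open>wp\<close> is false.\<close>

lemma wp_exec:
  assumes "wp S c Q \<sigma>"
  shows "\<exists>t s \<tau>. exec c \<sigma> t s \<tau> \<and> t \<le> cost c \<and> s \<le> S \<and> Q \<tau>"
  using assms
proof (induction c arbitrary: Q \<sigma>)
  case (Seq c1 c2)
  from Seq.IH(1)[of "wp S c2 Q" \<sigma>] Seq.prems obtain t1 s1 \<rho> where
    1: "exec c1 \<sigma> t1 s1 \<rho>" "t1 \<le> cost c1" "s1 \<le> S" "wp S c2 Q \<rho>" by auto
  from Seq.IH(2)[OF 1(4)] obtain t2 s2 \<tau> where
    2: "exec c2 \<rho> t2 s2 \<tau>" "t2 \<le> cost c2" "s2 \<le> S" "Q \<tau>" by auto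
  have "exec (Seq c1 c2) \<sigma> (t1 + t2) (max s1 s2) \<tau>" by (rule exec.Seq[OF 1(1) 2(1)])
  moreover have "t1 + t2 \<le> cost (Seq c1 c2)" "max s1 s2 \<le> S" using 1 2 by auto
  ultimately show ?case using 2(4) by blast
next
  case (IfLess x y c1 c2)
  obtain r m where \<sigma>: "\<sigma> = (r, m)" by force
  show ?case
  proof (cases "r x < r y")
    case True
    with IfLess.IH(1)[of Q \<sigma>] IfLess.prems \<sigma> obtain t s \<tau> where
      "exec c1 (r, m) t s \<tau>" "t \<le> cost c1" "s \<le> S" "Q \<tau>" by auto
    with exec.IfTrue[OF True this(1), of c2] show ?thesis
      unfolding \<sigma> by (intro exI[of _ "1 + t"] exI[of _ s] exI[of _ \<tau>]) auto
  next
    case False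
    with IfLess.IH(2)[of Q \<sigma>] IfLess.prems \<sigma> obtain t s \<tau> where
      "exec c2 (r, m) t s \<tau>" "t \<le> cost c2" "s \<le> S" "Q \<tau>" by auto
    with exec.IfFalse[OF False this(1), of c1] show ?thesis
      unfolding \<sigma> by (intro exI[of _ "1 + t"] exI[of _ s] exI[of _ \<tau>]) auto
  qed
next
  case (Load x a)
  obtain r m where \<sigma>: "\<sigma> = (r, m)" by force
  with Load have "0 \<le> r a" "Suc (nat (r a)) \<le> S" by auto
  with exec.Load[of r a x m] Load \<sigma> show ?case by fastforce
next
  case (Store a x)
  obtain r m where \<sigma>: "\<sigma> = (r, m)" by force
  with Store have "0 \<le> r a" "Suc (nat (r a)) \<le> S" by auto
  with exec.Store[of r a x m] Store \<sigma> show ?case by fastforce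
qed (fastforce intro: exec.intros)+

lemma triple_straight:
  assumes "\<And>r m. P (r, m) \<Longrightarrow> wp S c Q (r, m)" "cost c \<le> T"
  shows "triple S T P c Q"
  unfolding triple_def
proof (intro allI impI)
  fix \<sigma> assume "P \<sigma>"
  with assms(1) have "wp S c Q \<sigma>" by (cases \<sigma>) simp
  from wp_exec[OF this] assms(2) show "\<exists>t s \<tau>. exec c \<sigma> t s \<tau> \<and> t \<le> T \<and> s \<le> S \<and> Q \<tau>"
    by (meson order_trans)
qed

lemma triple_conseq:
  assumes "triple S T P c Q" "\<And>\<sigma>. P' \<sigma> \<Longrightarrow> P \<sigma>" "\<And>\<sigma>. Q \<sigma> \<Longrightarrow> Q' \<sigma>" "T \<le> T'"
  shows "triple S T' P' c Q'"
  using assms unfolding triple_def by (meson order_trans)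

lemma triple_Seq:
  assumes "triple S T1 P c1 R" "triple S T2 R c2 Q"
  shows "triple S (T1 + T2) P (Seq c1 c2) Q"
  unfolding triple_def
proof (intro allI impI)
  fix \<sigma> assume "P \<sigma>"
  with assms(1) obtain t1 s1 \<rho> where 1: "exec c1 \<sigma> t1 s1 \<rho>" "t1 \<le> T1" "s1 \<le> S" "R \<rho>"
    unfolding triple_def by blast
  with assms(2) obtain t2 s2 \<tau> where 2: "exec c2 \<rho> t2 s2 \<tau>" "t2 \<le> T2" "s2 \<le> S" "Q \<tau>"
    unfolding triple_def by blast
  have "exec (Seq c1 c2) \<sigma> (t1 + t2) (max s1 s2) \<tau>" by (rule exec.Seq[OF 1(1) 2(1)])
  moreover have "t1 + t2 \<le> T1 + T2" "max s1 s2 \<le> S" using 1 2 by auto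
  ultimately show "\<exists>t s \<tau>. exec (Seq c1 c2) \<sigma> t s \<tau> \<and> t \<le> T1 + T2 \<and> s \<le> S \<and> Q \<tau>"
    using 2(4) by blast
qed

text \<open>For loops whose number \<open>N\<close> of iterations is known beforehand; the invariant
  is indexed by the iterations already done. Each iteration pays for its body and one test, and the
  last \<open>+ 1\<close> is the failing test.\<close>

lemma triple_While:
  assumes body: "\<And>i. i < N \<Longrightarrow> triple S T (I i) c (I (Suc i))"
    and test: "\<And>i r m. i \<le> N \<Longrightarrow> I i (r, m) \<Longrightarrow> r x < r y \<longleftrightarrow> i < N"
  shows "triple S (N * (T + 1) + 1) (I 0) (WhileLess x y c) (I N)"
proof -
  \<comment> \<open>Induction on the number \<open>j\<close> of iterations still to come.\<close>
  have "\<exists>t s \<tau>. exec (WhileLess x y c) \<sigma> t s \<tau> \<and> t \<le> j * (T + 1) + 1 \<and> s \<le> S \<and> I N \<tau>"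
    if "j \<le> N" "I (N - j) \<sigma>" for j \<sigma>
    using that
  proof (induction j arbitrary: \<sigma>)
    case 0
    obtain r m where \<sigma>: "\<sigma> = (r, m)" by force
    with 0 test[of N r m] have "\<not> r x < r y" by simp
    from exec.WhileFalse[of r x y c m, OF this] 0 \<sigma> show ?case by fastforce
  next
    case (Suc j)
    obtain r m where \<sigma>: "\<sigma> = (r, m)" by force
    with Suc.prems test[of "N - Suc j" r m] have less: "r x < r y" by simp
    have "Suc (N - Suc j) = N - j" using Suc.prems by simp
    with body[of "N - Suc j"] Suc.prems \<sigma> obtain t1 s1 \<rho> where
      1: "exec c (r, m) t1 s1 \<rho>" "t1 \<le> T" "s1 \<le> S" "I (N - j) \<rho>"
      unfolding triple_def by (metis Suc_le_eq diff_less zero_less_Suc less_le_trans)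
    from Suc.IH[OF _ 1(4)] Suc.prems obtain t2 s2 \<tau> where
      2: "exec (WhileLess x y c) \<rho> t2 s2 \<tau>" "t2 \<le> j * (T + 1) + 1" "s2 \<le> S" "I N \<tau>" by auto
    have "exec (WhileLess x y c) \<sigma> (1 + t1 + t2) (max s1 s2) \<tau>"
      unfolding \<sigma> by (rule exec.WhileTrue[OF less 1(1) 2(1)])
    moreover have "1 + t1 + t2 \<le> Suc j * (T + 1) + 1" "max s1 s2 \<le> S" using 1 2 by auto
    ultimately show ?case using 2(4) by blast
  qed
  from this[of N] show ?thesis unfolding triple_def by simp
qed

section \<open>The program\<close>

abbreviation (input) "rAns \<equiv> 0 :: reg"
abbreviation (input) "rZero \<equiv> 2 :: reg"
abbreviation (input) "rOne \<equiv> 3 :: reg"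
abbreviation (input) "rM \<equiv> 4 :: reg"
abbreviation (input) "rN \<equiv> 5 :: reg"
abbreviation (input) "rRounds \<equiv> 6 :: reg"
abbreviation (input) "rEdges \<equiv> 7 :: reg"
abbreviation (input) "rVals \<equiv> 8 :: reg"
abbreviation (input) "rUpper \<equiv> 9 :: reg"
abbreviation (input) "rLower \<equiv> 10 :: reg"
abbreviation (input) "rEnd \<equiv> 11 :: reg"
abbreviation (input) "rI \<equiv> 12 :: reg"
abbreviation (input) "rP \<equiv> 13 :: reg"
abbreviation (input) "rU \<equiv> 14 :: reg"
abbreviation (input) "rV \<equiv> 15 :: reg"
abbreviation (input) "rX \<equiv> 16 :: reg"
abbreviation (input) "rY \<equiv> 17 :: reg"
abbreviation (input) "rT \<equiv> 18 :: reg"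
abbreviation (input) "rBound \<equiv> 19 :: reg"
abbreviation (input) "rOk \<equiv> 20 :: reg"

fun block :: "com list \<Rightarrow> com" where
  "block [] = Skip"
| "block [c] = c"
| "block (c # d # cs) = Seq c (block (d # cs))"

text \<open>\<open>rZero\<close> is never written and keeps its initial 0; it and
  \<open>rOne\<close> also serve as addresses of the first two header cells. The multiples
  \<open>2m\<close> and \<open>4m\<close> of the edge count \<open>m\<close> arise by doubling, as
  the machine cannot multiply.\<close>

definition setup_com :: "int \<Rightarrow> com" where
  "setup_com M = block
    [Const rOne 1, Const rM M, Load rN rZero, Load rX rOne, Add rT rOne rOne, Load rY rT,
     Add rEdges rT rOne, Add rT rX rX, Add rRounds rT rT, Add rVals rEdges rT,
     Add rUpper rVals rY, Add rUpper rUpper rY, Add rLower rUpper rN, Add rEnd rLower rN]"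

text \<open>Repeated under the round counter, this multiplies \<open>M\<close> by the number of
  rounds using additions only.\<close>

definition bound_com :: com where
  "bound_com = block [Add rBound rBound rM, Add rI rI rOne]"

definition fill_com :: com where
  "fill_com = block [Store rP rBound, Add rP rP rOne]"

definition pin_com :: com where
  "pin_com = block
    [Load rV rP, Add rP rP rOne, Load rX rP, Add rP rP rOne,
     Add rV rUpper rV, Store rV rX, Add rV rV rN, Sub rX rZero rX, Store rV rX]"

definition relax_com :: com where
  "relax_com = block
    [Load rX rU, Load rY rV, Add rT rX rM,
     IfLess rT rY (Store rV rT) (block [Add rT rY rM, IfLess rT rX (Store rU rT) Skip])]"

definition edge_com :: com where
  "edge_com = block
    [Load rU rP, Add rP rP rOne, Load rV rP, Add rP rP rOne, Add rU rUpper rU, Add rV rUpper rV,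
     relax_com, Add rU rU rN, Add rV rV rN, relax_com]"

definition round_com :: com where
  "round_com = Seq (Add rP rEdges rZero)
     (Seq (WhileLess rP rVals edge_com) (Add rI rI rOne))"

text \<open>One pass evaluates both conditions: \<open>rOk\<close> is a conjunction over the
  vertices and can only drop to 0, \<open>rAns\<close> a disjunction and can only rise to 1. The
  last conditional of \<open>extension_com\<close> combines them.\<close>

definition check_com :: com where
  "check_com = block
    [Load rX rP, Add rT rP rN, Load rY rT, Add rT rX rY, IfLess rT rZero (Const rOk 0) Skip,
     IfLess rX rZero Skip (IfLess rY rZero Skip (Const rAns 1)), Add rP rP rOne]"

definition extension_com :: "int \<Rightarrow> com" where
  "extension_com M =
     Seq (setup_com M)
    (Seq (WhileLess rI rRounds bound_com)
    (Seq (Add rP rUpper rZero)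
    (Seq (WhileLess rP rEnd fill_com)
    (Seq (Add rP rVals rZero)
    (Seq (WhileLess rP rUpper pin_com)
    (Seq (Const rI 0)
    (Seq (WhileLess rI rRounds round_com)
    (Seq (block [Add rP rUpper rZero, Const rOk 1])
    (Seq (WhileLess rP rLower check_com)
         (IfLess rOk rOne (Const rAns 0) Skip))))))))))"

section \<open>Memory layout: the input followed by the array of bounds\<close>

definition mem :: "int list \<Rightarrow> (nat \<Rightarrow> int) \<Rightarrow> nat \<Rightarrow> int" where
  "mem xs A = (\<lambda>a. if a < length xs then xs ! a else A (a - length xs))"

lemma mem_input: "a < length xs \<Longrightarrow> mem xs A a = xs ! a"
  by (simp add: mem_def)

lemma mem_array: "mem xs A (length xs + a) = A a"
  by (simp add: mem_def)

text \<open>Writes beyond the input preserve the shape \<open>mem xs A\<close>, so the later phases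
  only have to track the array \<open>A\<close>.\<close>

lemma mem_update: "(mem xs A)(length xs + a := w) = mem xs (A(a := w))"
  by (auto simp: mem_def fun_eq_iff)

lemma nth_concat_pairs:
  assumes "i < length ys"
  shows "concat (map (\<lambda>y. [f y, g y]) ys) ! (2 * i) = f (ys ! i)"
    and "concat (map (\<lambda>y. [f y, g y]) ys) ! Suc (2 * i) = g (ys ! i)"
  using assms by (induction ys arbitrary: i) (auto simp: less_Suc_eq_0_disj)

lemma length_concat_pairs: "length (concat (map (\<lambda>y. [f y, g y]) ys)) = 2 * length ys"
  by (induction ys) auto

declare relax.simps [simp del]

text \<open>The assumptions keep every array access inside the \<open>2 * n\<close> bounds. Time is
  measured in the list lengths here; the tree property enters only when these are compared with
  \<open>n\<close>.\<close>

locale extension_input =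
  fixes M :: int and n :: nat and es :: "(nat \<times> nat) list" and vs :: "nat list"
    and f' :: "nat \<Rightarrow> int"
  assumes edges_less: "\<And>u v. (u, v) \<in> set es \<Longrightarrow> u < n \<and> v < n"
    and values_less: "set vs \<subseteq> {..<n}"
begin

definition encoding :: "int list" where
  "encoding = [int n, int (length es), int (length vs)] @
     concat (map (\<lambda>(u, v). [int u, int v]) es) @ concat (map (\<lambda>v. [int v, f' v]) vs)"

abbreviation (input) "k \<equiv> length vs"
abbreviation (input) "m \<equiv> length es"
abbreviation (input) "L \<equiv> length encoding"

lemma length_input: "L = 3 + 2 * m + 2 * k"
  using length_concat_pairs[of "\<lambda>e. int (fst e)" "\<lambda>e. int (snd e)" es]
    length_concat_pairs[of int f' vs]
  by (simp add: encoding_def case_prod_unfold)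

lemma input_header: "encoding ! 0 = int n" "encoding ! 1 = int m" "encoding ! 2 = int k"
  by (simp_all add: encoding_def)

lemma input_edge:
  assumes "i < m"
  shows "encoding ! (3 + 2 * i) = int (fst (es ! i))" "encoding ! Suc (3 + 2 * i) = int (snd (es ! i))"
proof -
  let ?c = "concat (map (\<lambda>e. [int (fst e), int (snd e)]) es)"
  let ?d = "concat (map (\<lambda>v. [int v, f' v]) vs)"
  have c: "encoding = [int n, int m, int k] @ ?c @ ?d"
    by (simp add: encoding_def case_prod_unfold)
  have l: "length ?c = 2 * m" by (rule length_concat_pairs)
  have "encoding ! (3 + 2 * i) = ?c ! (2 * i)"
    using assms l unfolding c nth_append by simp
  moreover have "encoding ! Suc (3 + 2 * i) = ?c ! Suc (2 * i)"
    using assms l unfolding c nth_append by (simp add: numeral_eq_Suc)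
  ultimately show "encoding ! (3 + 2 * i) = int (fst (es ! i))"
    "encoding ! Suc (3 + 2 * i) = int (snd (es ! i))"
    using nth_concat_pairs[OF assms, of "\<lambda>e. int (fst e)" "\<lambda>e. int (snd e)"] by simp_all
qed

lemma input_value:
  assumes "i < k"
  shows "encoding ! (3 + 2 * m + 2 * i) = int (vs ! i)" "encoding ! Suc (3 + 2 * m + 2 * i) = f' (vs ! i)"
proof -
  let ?c = "[int n, int m, int k] @ concat (map (\<lambda>e. [int (fst e), int (snd e)]) es)"
  let ?d = "concat (map (\<lambda>v. [int v, f' v]) vs)"
  have c: "encoding = ?c @ ?d"
    by (simp add: encoding_def case_prod_unfold)
  have l: "length ?c = 3 + 2 * m"
    using length_concat_pairs[of "\<lambda>e. int (fst e)" "\<lambda>e. int (snd e)" es] by simp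
  have "encoding ! (3 + 2 * m + 2 * i) = ?d ! (2 * i)"
    unfolding c nth_append l by simp
  moreover have "encoding ! Suc (3 + 2 * m + 2 * i) = ?d ! Suc (2 * i)"
    unfolding c nth_append l by simp
  ultimately show "encoding ! (3 + 2 * m + 2 * i) = int (vs ! i)"
    "encoding ! Suc (3 + 2 * m + 2 * i) = f' (vs ! i)"
    using nth_concat_pairs[OF assms, of int f'] by simp_all
qed

text \<open>The registers fixed by the setup and left alone by all later phases: constants, the
  number of rounds, and the addresses where edges, prescribed values, upper bounds and negated lower
  bounds begin and where the array ends.\<close>

definition frame :: "(reg \<Rightarrow> int) \<Rightarrow> bool" where
  "frame r \<longleftrightarrow> r rZero = 0 \<and> r rOne = 1 \<and> r rM = M \<and> r rN = int n \<and> r rRounds = int (4 * m) \<and>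
     r rEdges = 3 \<and> r rVals = int (3 + 2 * m) \<and> r rUpper = int L \<and> r rLower = int (L + n) \<and>
     r rEnd = int (L + 2 * n)"

definition st :: "(nat \<Rightarrow> int) \<Rightarrow> ((reg \<Rightarrow> int) \<Rightarrow> bool) \<Rightarrow> state \<Rightarrow> bool" where
  "st A \<phi> = (\<lambda>(r, mm). frame r \<and> mm = mem encoding A \<and> \<phi> r)"

abbreviation (input) "S \<equiv> L + 2 * n"

section \<open>The phases of the program\<close>

lemma setup_triple:
  "triple S 20 (\<lambda>\<sigma>. \<sigma> = initial_state encoding) (setup_com M)
     (st (\<lambda>_. 0) (\<lambda>r. r rAns = 0 \<and> r rI = 0 \<and> r rBound = 0))"
proof (rule triple_straight)
  fix r :: "reg \<Rightarrow> int" and mm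
  assume "(r, mm) = initial_state encoding"
  then have *: "r = (\<lambda>_. 0)" "mm = mem encoding (\<lambda>_. 0)"
    by (auto simp: initial_state_def mem_def)
  have [simp]: "mem encoding (\<lambda>_. 0) 0 = int n" "mem encoding (\<lambda>_. 0) (Suc 0) = int m"
    "mem encoding (\<lambda>_. 0) 2 = int k"
    using input_header by (simp_all add: mem_def length_input)
  show "wp S (setup_com M) (st (\<lambda>_. 0) (\<lambda>r. r rAns = 0 \<and> r rI = 0 \<and> r rBound = 0)) (r, mm)"
    unfolding * by (simp add: setup_com_def st_def frame_def length_input)
qed (simp add: setup_com_def)

lemma bound_triple:
  "triple S (4 * m * 3 + 1) (st A (\<lambda>r. r rAns = 0 \<and> r rI = 0 \<and> r rBound = 0))
     (WhileLess rI rRounds bound_com) (st A (\<lambda>r. r rAns = 0 \<and> r rBound = M * int (4 * m)))"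
proof -
  let ?I = "\<lambda>i. st A (\<lambda>r. r rAns = 0 \<and> r rI = int i \<and> r rBound = M * int i)"
  have "triple S (4 * m * (2 + 1) + 1) (?I 0) (WhileLess rI rRounds bound_com) (?I (4 * m))"
  proof (rule triple_While)
    show "triple S 2 (?I i) bound_com (?I (Suc i))" if "i < 4 * m" for i
      by (rule triple_straight)
        (auto simp: bound_com_def st_def frame_def algebra_simps)
  qed (auto simp: st_def frame_def)
  then show ?thesis by (rule triple_conseq) (auto simp: st_def)
qed

lemma fill_triple:
  "triple S (2 * n * 3 + 1) (st (\<lambda>_. 0) (\<lambda>r. r rAns = 0 \<and> r rBound = B \<and> r rP = int L))
     (WhileLess rP rEnd fill_com) (st (\<lambda>a. if a < 2 * n then B else 0) (\<lambda>r. r rAns = 0))"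
proof -
  let ?I = "\<lambda>i. st (\<lambda>a. if a < i then B else 0)
    (\<lambda>r. r rAns = 0 \<and> r rBound = B \<and> r rP = int (L + i))"
  have "triple S (2 * n * (2 + 1) + 1) (?I 0) (WhileLess rP rEnd fill_com) (?I (2 * n))"
  proof (rule triple_While)
    fix i assume i: "i < 2 * n"
    have [simp]: "nat (int L + int i) = L + i" by simp
    have [simp]: "(\<lambda>a. if a < i then B else 0)(i := B) = (\<lambda>a. if a < Suc i then B else 0)"
      by (auto simp: fun_eq_iff)
    show "triple S 2 (?I i) fill_com (?I (Suc i))"
      by (rule triple_straight) (use i in \<open>auto simp: fill_com_def st_def frame_def mem_update\<close>)
  qed (auto simp: st_def frame_def)
  then show ?thesis by (rule triple_conseq) (auto simp: st_def)
qed

lemma pin_triple: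
  "triple S (k * 10 + 1) (st A (\<lambda>r. r rAns = 0 \<and> r rP = int (3 + 2 * m)))
     (WhileLess rP rUpper pin_com) (st (fold (pin n f') vs A) (\<lambda>r. r rAns = 0))"
proof -
  let ?I = "\<lambda>i. st (fold (pin n f') (take i vs) A)
    (\<lambda>r. r rAns = 0 \<and> r rP = int (3 + 2 * m + 2 * i))"
  have "triple S (k * (9 + 1) + 1) (?I 0) (WhileLess rP rUpper pin_com) (?I k)"
  proof (rule triple_While)
    fix i assume i: "i < k"
    define v where "v = vs ! i"
    define q where "q = 3 + 2 * m + 2 * i"
    define A' where "A' = fold (pin n f') (take i vs) A"
    have v: "v < n" using values_less nth_mem[OF i] by (auto simp: v_def)
    have q: "Suc q < L" using i by (simp add: q_def length_input)
    moreover have "encoding ! q = int v" "encoding ! Suc q = f' v"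
      unfolding q_def v_def by (rule input_value[OF i])+
    ultimately have [simp]: "mem encoding A' q = int v" "mem encoding A' (Suc q) = f' v"
      by (simp_all add: mem_input)
    have [simp]: "nat (int q + 1) = Suc q" "nat (int L + int v) = L + v"
      "nat (int L + int v + int n) = L + (n + v)" by simp_all
    have step: "fold (pin n f') (take (Suc i) vs) A = A'(v := f' v, n + v := - f' v)"
      using i by (simp add: take_Suc_conv_app_nth A'_def v_def pin_def)
    have q': "3 + 2 * m + 2 * Suc i = Suc (Suc q)" by (simp add: q_def)
    show "triple S 9 (?I i) pin_com (?I (Suc i))"
      unfolding step q' A'_def[symmetric] q_def[symmetric]
      by (rule triple_straight)
        (use q v in \<open>auto simp: pin_com_def st_def frame_def mem_update\<close>)
  qed (auto simp: st_def frame_def length_input)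
  then show ?thesis by (rule triple_conseq) (auto simp: st_def)
qed

text \<open>Stated for array indices \<open>a\<close> and \<open>b\<close>, so that it serves both
  copies of the graph. The postcondition has to tolerate any contents of the three scratch
  registers, which makes it independent of the branch taken.\<close>

lemma wp_relax:
  assumes "frame r" "r rU = int (L + a)" "r rV = int (L + b)" "a < 2 * n" "b < 2 * n"
    and "\<And>x y t. Q (r(rX := x, rY := y, rT := t), mem encoding (relax M (a, b) A))"
  shows "wp S relax_com Q (r, mem encoding A)"
proof -
  have [simp]: "nat (int L + int a) = L + a" "nat (int L + int b) = L + b" by simp_all
  show ?thesis
    using assms by (auto simp: relax_com_def relax.simps frame_def mem_array mem_update)
qed

lemma edge_triple:
  assumes i: "i < m"
  shows "triple S 40
    (st A (\<lambda>r. r rAns = 0 \<and> r rI = j \<and> r rP = int (3 + 2 * i))) edge_com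
    (st (relax_both M n (es ! i) A) (\<lambda>r. r rAns = 0 \<and> r rI = j \<and> r rP = int (3 + 2 * Suc i)))"
proof -
  define u where "u = fst (es ! i)"
  define v where "v = snd (es ! i)"
  define q where "q = 3 + 2 * i"
  have e: "es ! i = (u, v)" by (simp add: u_def v_def)
  then have uv: "u < n" "v < n" using edges_less nth_mem[OF i] by auto
  have q: "Suc q < L" using i by (simp add: q_def length_input)
  moreover have "encoding ! q = int u" "encoding ! Suc q = int v"
    unfolding q_def u_def v_def by (rule input_edge[OF i])+
  ultimately have [simp]: "mem encoding A' q = int u" "mem encoding A' (Suc q) = int v" for A'
    by (simp_all add: mem_input)
  have [simp]: "nat (int q + 1) = Suc q" by simp
  have q': "3 + 2 * Suc i = Suc (Suc q)" by (simp add: q_def)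
  let ?Q = "st (relax_both M n (u, v) A) (\<lambda>r. r rAns = 0 \<and> r rI = j \<and> r rP = int (Suc (Suc q)))"
  show ?thesis
    unfolding q' q_def[symmetric] e
  proof (rule triple_straight)
    fix r mm assume "st A (\<lambda>r. r rAns = 0 \<and> r rI = j \<and> r rP = int q) (r, mm)"
    then have r: "frame r" "r rAns = 0" "r rI = j" "r rP = int q" and mm: "mm = mem encoding A"
      by (auto simp: st_def)
    then have c: "r rOne = 1" "r rUpper = int L" "r rN = int n" by (auto simp: frame_def)
    show "wp S edge_com ?Q (r, mm)"
      \<comment> \<open>The two occurrences of \<open>relax_com\<close> stay folded and are
        discharged by \<open>wp_relax\<close>, first for the upper and then for the lower
        copy.\<close>
      unfolding mm edge_com_def block.simps wp.simps(1-6) wp.simps(7) prod.case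
      using q r c
      apply simp
      apply (rule wp_relax[where a = u and b = v])
      subgoal by (simp add: frame_def)
      subgoal by simp
      subgoal by simp
      subgoal using uv by simp
      subgoal using uv by simp
      apply simp
      apply (rule wp_relax[where a = "n + u" and b = "n + v"])
      subgoal by (simp add: frame_def)
      subgoal by simp
      subgoal by simp
      subgoal using uv by simp
      subgoal using uv by simp
      subgoal by (simp add: st_def frame_def)
      done
  qed (simp add: edge_com_def relax_com_def)
qed

lemma round_triple:
  "triple S (m * 41 + 3) (st A (\<lambda>r. r rAns = 0 \<and> r rI = j)) round_com
     (st (fold (relax_both M n) es A) (\<lambda>r. r rAns = 0 \<and> r rI = j + 1))"
proof -
  let ?I = "\<lambda>i. st (fold (relax_both M n) (take i es) A)
    (\<lambda>r. r rAns = 0 \<and> r rI = j \<and> r rP = int (3 + 2 * i))"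
  have loop: "triple S (m * (40 + 1) + 1) (?I 0) (WhileLess rP rVals edge_com) (?I m)"
  proof (rule triple_While)
    fix i assume i: "i < m"
    show "triple S 40 (?I i) edge_com (?I (Suc i))"
      using edge_triple[OF i, of "fold (relax_both M n) (take i es) A" j] i
      by (simp add: take_Suc_conv_app_nth)
  qed (auto simp: st_def frame_def)
  have init: "triple S 1 (st A (\<lambda>r. r rAns = 0 \<and> r rI = j)) (Add rP rEdges rZero) (?I 0)"
    by (rule triple_straight) (auto simp: st_def frame_def)
  have incr: "triple S 1 (?I m) (Add rI rI rOne)
      (st (fold (relax_both M n) es A) (\<lambda>r. r rAns = 0 \<and> r rI = j + 1))"
    by (rule triple_straight) (auto simp: st_def frame_def)
  show ?thesis unfolding round_com_def
    by (rule triple_conseq[OF triple_Seq[OF init triple_Seq[OF loop incr]]]) auto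
qed

text \<open>The dominant phase: \<open>4 * m\<close> rounds over \<open>m\<close> edges produce the
  quadratic term.\<close>

lemma rounds_triple:
  "triple S (4 * m * (m * 41 + 4) + 1) (st A (\<lambda>r. r rAns = 0 \<and> r rI = 0))
     (WhileLess rI rRounds round_com)
     (st ((fold (relax_both M n) es ^^ (4 * m)) A) (\<lambda>r. r rAns = 0))"
proof -
  let ?I = "\<lambda>i. st ((fold (relax_both M n) es ^^ i) A) (\<lambda>r. r rAns = 0 \<and> r rI = int i)"
  have "triple S (4 * m * (m * 41 + 3 + 1) + 1) (?I 0) (WhileLess rI rRounds round_com) (?I (4 * m))"
  proof (rule triple_While)
    fix i
    show "triple S (m * 41 + 3) (?I i) round_com (?I (Suc i))"
      using round_triple[of "(fold (relax_both M n) es ^^ i) A" "int i"] by (simp add: add.commute)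
  qed (auto simp: st_def frame_def)
  then show ?thesis by (rule triple_conseq) (auto simp: st_def)
qed

lemma check_triple:
  "triple S (n * 21 + 1) (st A (\<lambda>r. r rAns = 0 \<and> r rP = int L \<and> r rOk = 1))
     (WhileLess rP rLower check_com)
     (st A (\<lambda>r. r rOk = (if \<forall>v<n. 0 \<le> A v + A (n + v) then 1 else 0) \<and>
                r rAns = (if \<exists>v<n. 0 \<le> A v \<and> 0 \<le> A (n + v) then 1 else 0)))"
proof -
  let ?I = "\<lambda>i. st A (\<lambda>r. r rP = int (L + i) \<and>
    r rOk = (if \<forall>v<i. 0 \<le> A v + A (n + v) then 1 else 0) \<and>
    r rAns = (if \<exists>v<i. 0 \<le> A v \<and> 0 \<le> A (n + v) then 1 else 0))"
  have "triple S (n * (20 + 1) + 1) (?I 0) (WhileLess rP rLower check_com) (?I n)"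
  proof (rule triple_While)
    fix i assume i: "i < n"
    have [simp]: "nat (int L + int i) = L + i" "nat (int L + int i + int n) = L + (n + i)"
      by simp_all
    show "triple S 20 (?I i) check_com (?I (Suc i))"
    proof (rule triple_straight)
      fix r mm assume "?I i (r, mm)"
      then show "wp S check_com (?I (Suc i)) (r, mm)"
        using i by (auto simp: check_com_def st_def frame_def mem_array All_less_Suc Ex_less_Suc)
    qed (simp add: check_com_def)
  qed (auto simp: st_def frame_def)
  then show ?thesis by (rule triple_conseq) (auto simp: st_def)
qed

text \<open>The time adds up over the phases: of \<open>28 * m\<close>, 16 come from the rounds and
  12 from computing the initial bound; of \<open>n * 27\<close>, 6 come from filling the array and
  21 from the final check.\<close>

lemma extension_triple:
  fixes A :: "nat \<Rightarrow> int"
  defines "A \<equiv> (fold (relax_both M n) es ^^ (4 * m)) (init_bounds (M * int (4 * m)) n f' vs)"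
  shows "triple S (m * (m * 164 + 28) + k * 10 + n * 27 + 40)
    (\<lambda>\<sigma>. \<sigma> = initial_state encoding) (extension_com M)
    (\<lambda>\<sigma>. fst \<sigma> 0 = (if (\<forall>v<n. 0 \<le> A v + A (n + v)) \<and> (\<exists>v<n. 0 \<le> A v \<and> 0 \<le> A (n + v))
      then 1 else 0))"
proof -
  let ?B = "M * int (4 * m)"
  let ?F = "\<lambda>a. if a < 2 * n then ?B else 0"
  have s3: "triple S 1 (st (\<lambda>_. 0) (\<lambda>r. r rAns = 0 \<and> r rBound = ?B)) (Add rP rUpper rZero)
      (st (\<lambda>_. 0) (\<lambda>r. r rAns = 0 \<and> r rBound = ?B \<and> r rP = int L))"
    by (rule triple_straight) (auto simp: st_def frame_def)
  have s5: "triple S 1 (st ?F (\<lambda>r. r rAns = 0)) (Add rP rVals rZero)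
      (st ?F (\<lambda>r. r rAns = 0 \<and> r rP = int (3 + 2 * m)))"
    by (rule triple_straight) (auto simp: st_def frame_def)
  have s7: "triple S 1 (st (init_bounds ?B n f' vs) (\<lambda>r. r rAns = 0)) (Const rI 0)
      (st (init_bounds ?B n f' vs) (\<lambda>r. r rAns = 0 \<and> r rI = 0))"
    by (rule triple_straight) (auto simp: st_def frame_def)
  have s9: "triple S 2 (st A (\<lambda>r. r rAns = 0)) (block [Add rP rUpper rZero, Const rOk 1])
      (st A (\<lambda>r. r rAns = 0 \<and> r rP = int L \<and> r rOk = 1))"
    by (rule triple_straight) (auto simp: st_def frame_def)
  have s11: "triple S 3
      (st A (\<lambda>r. r rOk = (if \<forall>v<n. 0 \<le> A v + A (n + v) then 1 else 0) \<and>
                r rAns = (if \<exists>v<n. 0 \<le> A v \<and> 0 \<le> A (n + v) then 1 else 0)))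
      (IfLess rOk rOne (Const rAns 0) Skip)
      (\<lambda>\<sigma>. fst \<sigma> 0 = (if (\<forall>v<n. 0 \<le> A v + A (n + v)) \<and> (\<exists>v<n. 0 \<le> A v \<and> 0 \<le> A (n + v))
        then 1 else 0))"
    by (rule triple_straight) (auto simp: st_def frame_def)
  note s6 = pin_triple[of ?F, folded init_bounds_def]
  note s8 = rounds_triple[of "init_bounds ?B n f' vs", folded A_def]
  show ?thesis
    unfolding extension_com_def
    by (rule triple_conseq[OF triple_Seq[OF setup_triple triple_Seq[OF bound_triple
          triple_Seq[OF s3 triple_Seq[OF fill_triple triple_Seq[OF s5 triple_Seq[OF s6
          triple_Seq[OF s7 triple_Seq[OF s8 triple_Seq[OF s9
          triple_Seq[OF check_triple s11]]]]]]]]]]])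
      (auto simp: algebra_simps)
qed

end

theorem theorem5:
  fixes M :: int
  assumes "M > 0"
  shows "solvable_in_time_space tree_extension_instances extension_encodings
           (extension_answer M) num_vertices (\<lambda>n. real n ^ 2) (\<lambda>n. real n)"
proof -
  \<comment> \<open>With \<open>m\<close> and \<open>k\<close> at most \<open>n\<close>, the time is
    at most \<open>164 * n ^ 2 + 65 * n + 40\<close>, and 400 exceeds the sum of these coefficients.
    The 9 covers the input and the array, \<open>3 + 2 * m + 2 * k + 2 * n\<close> cells.\<close>
  let ?P = "extension_com M" and ?T = "\<lambda>n. 400 * n ^ 2"
  let ?S = "\<lambda>n. (card (registers ?P) + 9) * n"
  show ?thesis
    unfolding solvable_in_time_space_def
  proof (rule exI[of _ ?P], rule exI[of _ ?T], rule exI[of _ ?S], intro conjI ballI)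
    show "(\<lambda>n. real (?T n)) \<in> O(\<lambda>n. real n ^ 2)" "(\<lambda>n. real (?S n)) \<in> O(\<lambda>n. real n)"
      by simp_all
    fix I xs assume I: "I \<in> tree_extension_instances" and xs: "xs \<in> extension_encodings I"
    obtain n E V' f' where I_eq: "I = ({..<n}, E, V', f')" and tree: "tree_graph {..<n} E"
      and V': "V' \<subseteq> {..<n}"
      using I unfolding tree_extension_instances_def by blast
    obtain es vs where xs_eq: "xs = [int n, int (length es), int (length vs)] @
          concat (map (\<lambda>(u, v). [int u, int v]) es) @ concat (map (\<lambda>v. [int v, f' v]) vs)"
      and es: "distinct (map (\<lambda>(u, v). {u, v}) es)" "set (map (\<lambda>(u, v). {u, v}) es) = E"
      and vs: "distinct vs" "set vs = V'"
      using xs unfolding I_eq by auto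
    have E: "E = (\<lambda>(u, v). {u, v}) ` set es" using es(2) by simp
    have simple: "simple_graph {..<n} E" and conn: "connected_graph {..<n} E"
      and acyc: "\<nexists>p. graph_cycle E p"
      using tree by (auto simp: tree_graph_def)
    have es_less: "u < n \<and> v < n" if "(u, v) \<in> set es" for u v
      using simple_graph_subset[OF simple, of "{u, v}"] that unfolding E by force
    interpret extension_input M n es vs f'
      by unfold_locales (use es_less vs V' in auto)
    have xs_enc: "xs = encoding" by (simp add: xs_eq encoding_def)
    have size: "num_vertices I = n" by (simp add: I_eq)
    \<comment> \<open>A connected graph is nonempty by definition; this lets multiples of
      \<open>n\<close> absorb the constants.\<close>
    have n: "n \<ge> 1" using conn by (cases n) (auto simp: connected_graph_def)
    \<comment> \<open>The only use of acyclicity. The edges are listed without repetition, so the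
      length of the list is \<open>card E\<close>.\<close>
    have m: "length es \<le> n"
      using acyclic_graph_card_edges[OF simple acyc] distinct_card[OF es(1)] es(2) by simp
    have k: "length vs \<le> n"
      using card_mono[OF _ V'] distinct_card[OF vs(1)] vs(2) by simp
    have answer: "extension_answer M I \<longleftrightarrow>
        (\<forall>v<n. 0 \<le> A v + A (n + v)) \<and> (\<exists>v<n. 0 \<le> A v \<and> 0 \<le> A (n + v))"
      if "A = (fold (relax_both M n) es ^^ (4 * length es))
        (init_bounds (M * int (4 * length es)) n f' vs)" for A
      using extension_iff_bounds[OF _ conn[unfolded E] es_less values_less that] assms
      by (simp add: I_eq E vs(2))
    obtain t s \<tau> where run: "exec ?P (initial_state encoding) t s \<tau>"
      "t \<le> length es * (length es * 164 + 28) + length vs * 10 + n * 27 + 40"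
      "s \<le> length encoding + 2 * n" "fst \<tau> 0 = (if extension_answer M I then 1 else 0)"
      using extension_triple unfolding triple_def answer[OF refl] by blast
    have "length es * (length es * 164 + 28) \<le> n * (n * 164 + 28)"
      by (intro mult_mono add_mono) (use m in auto)
    also have "\<dots> = 164 * n ^ 2 + 28 * n" by (simp add: power2_eq_square algebra_simps)
    finally have "t \<le> 164 * n ^ 2 + 65 * n + 40" using run(2) k by linarith
    moreover have "n \<le> n ^ 2" "1 \<le> n ^ 2" using n by (auto simp: power2_eq_square)
    ultimately have "t \<le> ?T n" by linarith
    moreover have "card (registers ?P) + max (length xs) s \<le> ?S n"
    proof -
      have "max (length xs) s \<le> 9 * n"
        using run(3) m k n by (simp add: xs_enc length_input)
      moreover have "card (registers ?P) \<le> card (registers ?P) * n" using n by simp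
      ultimately show ?thesis unfolding distrib_right by (intro add_mono)
    qed
    ultimately show "\<exists>t s \<tau>. exec ?P (initial_state xs) t s \<tau> \<and>
        fst \<tau> 0 = (if extension_answer M I then 1 else 0) \<and>
        t \<le> ?T (num_vertices I) \<and> card (registers ?P) + max (length xs) s \<le> ?S (num_vertices I)"
      using run(1,4) unfolding xs_enc size by blast
  qed
qed

end
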